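(* Let $f,u,g$ be scalar-output neural networks of the same architecture under NTK parametrization, with independent initializations $\theta_0,\vartheta_0,\psi_0\sim\mathcal N(0,I)$ respectively, considered in the infinite-width limit. Let $\mathcal X=\{x_i\}_{i=1}^{N_D}\subset\mathbb R^{d_{\rm in}}$ be a finite training set with arbitrary labels $\mathcal Y\in\mathbb R^{N_D}$, and assume that the NTK Gram matrix $\Theta_{\mathcal X\mathcal X}$ is positive definite. Let $f(x;\theta_\infty)$ be the $t\to\infty$ limit of gradient flow on $\frac12\|f(\mathcal X;\theta_t)-\mathcal Y\|_2^2$, let $u(x;\vartheta_\infty)$ be the $t\to\infty$ limit of gradient flow on $\frac12\|u(\mathcal X;\vartheta_t)-g(\mathcal X;\psi_0)\|_2^2$, and let $\epsilon(x;\vartheta_\infty,\psi_0)=u(x;\vartheta_\infty)-g(x;\psi_0)$. Then for every $x\in\mathbb R^{d_{\rm in}}$, $$\tfrac12\,\mathbb E_{\vartheta_0,\psi_0}\bigl[\epsilon^2(x;\vartheta_\infty,\psi_0)\bigr]=\mathbb V_{\theta_0}\bigl[f(x;\theta_\infty)\bigr].$$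
   Context: Networks (NTK parametrization). A fully connected network $f(x;\theta)$ with $L$ layers and hidden widths $n_1=\dots=n_{L-1}=n$, input dimension $n_0=d_{\rm in}$, is defined by $z^l_i(x)=\sigma_b b^l_i+\frac{\sigma_w}{\sqrt{n_{l-1}}}\sum_{j=1}^{n_{l-1}}w^l_{ij}x^l_j(x)$, $x^1(x)=x$, $x^l_j(x)=\phi(z^{l-1}_j(x))$ for $l\ge2$, $f(x;\theta)=z^L(x)$ (scalar output), where $\phi:\mathbb R\to\mathbb R$ is a Lipschitz nonlinearity, $\sigma_w,\sigma_b$ are constants and $\theta$ collects all $w^l,b^l$, which are i.i.d. standard normal at initialization. Kernels. NNGP kernel: $\kappa(x,x')=\lim_{n\to\infty}\mathbb E_{\theta_0}[f(x;\theta_0)f(x';\theta_0)]$. Neural tangent kernel (NTK): $\Theta(x,x')=\lim_{n\to\infty}\nabla_\theta f(x;\theta_0)^\top\nabla_\theta f(x';\theta_0)$, a deterministic limit in probability. Networks of the same architecture (same $L,\phi,\sigma_w,\sigma_b,d_{\rm in}$) share the same $\kappa$ and $\Theta$. Infinite-width regime (standing convention, taken from the literature): in the limit $n\to\infty$, (i) the initial function $f(\cdot;\theta_0)$ is a centered Gaussian process with kernel $\kappa$ (limit in distribution of finite-dimensional marginals); networks with independent parameters have independent limits; (ii) the tangent kernel stays equal to $\Theta$ for all training times, so gradient flow $\frac{d}{dt}\theta_t=-\nabla_\theta\mathcal L(\theta_t)$ on $\mathcal L=\frac12\|f(\mathcal X;\theta_t)-\mathcal Y\|_2^2$ becomes the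 linear ODE $\frac{d}{dt}f(x;\theta_t)=-\Theta(x,\mathcal X)\,(f(\mathcal X;\theta_t)-\mathcal Y)$, started at $f(\cdot;\theta_0)$. $\theta_\infty$ denotes the limit $t\to\infty$ of these infinite-width dynamics. Notation. For finite point sets $A,B$, $f(A)$ is the vector of values and $k_{AB}=(k(a,b))_{a\in A,b\in B}$ for a kernel $k$. $\mathbb V$ denotes variance over the random initialization. *)

theory Defs
  imports "HOL-Probability.Probability"
begin

section \<open>Finite-width networks in NTK parametrization\<close>

record arch =
  depth :: nat
  act :: "real \<Rightarrow> real"
  sigma_w :: real
  sigma_b :: real

text \<open>
  The input space is \<open>real ^ 'd\<close>, so first-layer weights \<open>w\<^sup>1\<^sub>i\<^sub>j\<close> (\<open>InWeight i j\<close>) have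
  their second index in \<open>'d\<close>; all other neurons are numbered from 0.
  \<open>Weight l i j\<close> is \<open>w\<^sup>l\<^sub>i\<^sub>j\<close> for \<open>l \<ge> 2\<close>, and \<open>Bias l i\<close> is \<open>b\<^sup>l\<^sub>i\<close>.
\<close>

datatype 'd param = InWeight nat 'd | Weight nat nat nat | Bias nat nat

definition width :: "arch \<Rightarrow> nat \<Rightarrow> nat \<Rightarrow> nat" where
  "width A n l = (if l = depth A then 1 else n)"

definition params :: "arch \<Rightarrow> nat \<Rightarrow> 'd::finite param set" where
  "params A n =
     {InWeight i j | i j. i < width A n 1} \<union>
     {Weight l i j | l i j. 2 \<le> l \<and> l \<le> depth A \<and> i < width A n l \<and> j < n} \<union>
     {Bias l i | l i. 1 \<le> l \<and> l \<le> depth A \<and> i < width A n l}"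

text \<open>\<open>preact A n \<theta> x l i\<close> is \<open>z\<^sup>l\<^sub>i(x)\<close>. Layers are numbered from 1; the value at \<open>l = 0\<close> is junk.\<close>

fun preact ::
  "arch \<Rightarrow> nat \<Rightarrow> ('d::finite param \<Rightarrow> real) \<Rightarrow> real ^ 'd \<Rightarrow> nat \<Rightarrow> nat \<Rightarrow> real" where
  "preact A n \<theta> x 0 i = 0"
| "preact A n \<theta> x (Suc 0) i =
     sigma_b A * \<theta> (Bias 1 i) +
     sigma_w A / sqrt (real CARD('d)) * (\<Sum>j\<in>UNIV. \<theta> (InWeight i j) * x $ j)"
| "preact A n \<theta> x (Suc (Suc l)) i =
     sigma_b A * \<theta> (Bias (Suc (Suc l)) i) +
     sigma_w A / sqrt (real n) *
       (\<Sum>j<n. \<theta> (Weight (Suc (Suc l)) i j) * act A (preact A n \<theta> x (Suc l) j))"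

definition net :: "arch \<Rightarrow> nat \<Rightarrow> ('d::finite param \<Rightarrow> real) \<Rightarrow> real ^ 'd \<Rightarrow> real" where
  "net A n \<theta> x = preact A n \<theta> x (depth A) 0"

definition init_law :: "arch \<Rightarrow> nat \<Rightarrow> ('d::finite param \<Rightarrow> real) measure" where
  "init_law A n = PiM (params A n) (\<lambda>_. density lborel std_normal_density)"


section \<open>The two limit kernels\<close>

definition is_nngp_kernel ::
  "arch \<Rightarrow> (real ^ 'd::finite \<Rightarrow> real ^ 'd \<Rightarrow> real) \<Rightarrow> bool" where
  "is_nngp_kernel A \<kappa> \<longleftrightarrow>
     (\<forall>x x'. (\<lambda>n. \<integral>\<theta>. net A n \<theta> x * net A n \<theta> x' \<partial>init_law A n) \<longlonglongrightarrow> \<kappa> x x')"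

text \<open>
  A Lipschitz activation (e.g. ReLU) need not be differentiable everywhere, but the network is
  locally Lipschitz in its parameters, so for each input the partial derivatives below exist
  for almost every \<open>\<theta>\<close>. The arbitrary value of \<^const>\<open>deriv\<close> on the exceptional null set
  does not affect the limit in probability.
\<close>

definition tangent_kernel ::
  "arch \<Rightarrow> nat \<Rightarrow> ('d::finite param \<Rightarrow> real) \<Rightarrow> real ^ 'd \<Rightarrow> real ^ 'd \<Rightarrow> real" where
  "tangent_kernel A n \<theta> x x' =
     (\<Sum>p\<in>params A n. deriv (\<lambda>t. net A n (\<theta>(p := t)) x) (\<theta> p) *
                     deriv (\<lambda>t. net A n (\<theta>(p := t)) x') (\<theta> p))"

text \<open>
  The random variables may live on different spaces, as only the limit is deterministic.
  Measurability is part of the definition because \<^const>\<open>measure\<close> is 0 on non-measurable sets.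
\<close>

definition tends_in_prob ::
  "(nat \<Rightarrow> 'a measure) \<Rightarrow> (nat \<Rightarrow> 'a \<Rightarrow> real) \<Rightarrow> real \<Rightarrow> bool" where
  "tends_in_prob M Z c \<longleftrightarrow>
     (\<forall>n. Z n \<in> borel_measurable (M n)) \<and>
     (\<forall>e>0. (\<lambda>n. measure (M n) {\<omega> \<in> space (M n). e < \<bar>Z n \<omega> - c\<bar>}) \<longlonglongrightarrow> 0)"

definition is_ntk ::
  "arch \<Rightarrow> (real ^ 'd::finite \<Rightarrow> real ^ 'd \<Rightarrow> real) \<Rightarrow> bool" where
  "is_ntk A \<Theta> \<longleftrightarrow>
     (\<forall>x x'. tends_in_prob (init_law A) (\<lambda>n \<theta>. tangent_kernel A n \<theta> x x') (\<Theta> x x'))"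


section \<open>Infinite-width networks at initialization\<close>

text \<open>Normal laws, with point masses as the degenerate case of variance 0.\<close>

definition gaussian_law :: "real measure \<Rightarrow> bool" where
  "gaussian_law D \<longleftrightarrow>
     (\<exists>m. D = return borel m) \<or>
     (\<exists>m s. 0 < s \<and> D = density lborel (normal_density m s))"

text \<open>
  A random vector is Gaussian iff all its linear combinations are; this formulation
  also covers singular covariance matrices.
\<close>

definition gaussian_process :: "'w measure \<Rightarrow> ('w \<Rightarrow> 'a \<Rightarrow> real) \<Rightarrow> bool" where
  "gaussian_process M Z \<longleftrightarrow>
     (\<forall>x. (\<lambda>\<omega>. Z \<omega> x) \<in> borel_measurable M) \<and>
     (\<forall>S c. finite S \<longrightarrow> gaussian_law (distr M borel (\<lambda>\<omega>. \<Sum>a\<in>S. c a * Z \<omega> a)))"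

definition centered_gp ::
  "'w measure \<Rightarrow> ('a \<Rightarrow> 'a \<Rightarrow> real) \<Rightarrow> ('w \<Rightarrow> 'a \<Rightarrow> real) \<Rightarrow> bool" where
  "centered_gp M \<kappa> Z \<longleftrightarrow>
     gaussian_process M Z \<and>
     (\<forall>x. (\<integral>\<omega>. Z \<omega> x \<partial>M) = 0) \<and>
     (\<forall>x x'. (\<integral>\<omega>. Z \<omega> x * Z \<omega> x' \<partial>M) = \<kappa> x x')"

text \<open>
  Convergence in distribution of all finite-dimensional marginals. A marginal on a finite set
  \<open>S\<close> is the restriction to \<open>S\<close>, and continuity of the test function \<open>h\<close> refers to the product
  topology on functions; on restrictions to \<open>S\<close> these test functions are exactly the bounded
  continuous functions of the values at the points of \<open>S\<close>.
\<close>

definition marginals_tend_to ::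
  "(nat \<Rightarrow> 'v measure) \<Rightarrow> (nat \<Rightarrow> 'v \<Rightarrow> 'a \<Rightarrow> real) \<Rightarrow> 'w measure \<Rightarrow> ('w \<Rightarrow> 'a \<Rightarrow> real) \<Rightarrow> bool" where
  "marginals_tend_to P X M Z \<longleftrightarrow>
     (\<forall>S. finite S \<longrightarrow>
       (\<forall>h :: ('a \<Rightarrow> real) \<Rightarrow> real. continuous_on UNIV h \<and> bounded (range h) \<longrightarrow>
         (\<lambda>n. \<integral>v. h (restrict (X n v) S) \<partial>P n) \<longlonglongrightarrow> (\<integral>\<omega>. h (restrict (Z \<omega>) S) \<partial>M)))"

definition infinite_width_init ::
  "arch \<Rightarrow> (real ^ 'd::finite \<Rightarrow> real ^ 'd \<Rightarrow> real) \<Rightarrow> 'w measure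
     \<Rightarrow> ('w \<Rightarrow> real ^ 'd \<Rightarrow> real) \<Rightarrow> bool" where
  "infinite_width_init A \<kappa> M Z \<longleftrightarrow>
     marginals_tend_to (init_law A) (net A) M Z \<and> centered_gp M \<kappa> Z"


section \<open>Infinite-width training dynamics\<close>

text \<open>
  \<open>F t x\<close> is the value at \<open>x\<close> of the network trained for time \<open>t\<close> on the squared loss with
  training points \<open>xs i\<close> and labels \<open>ys i\<close> for \<open>i < N\<close>, starting from the function \<open>F0\<close>. In the
  infinite-width regime the tangent kernel stays equal to \<open>\<Theta>\<close>, so gradient flow in parameter
  space is this linear equation in function space.
\<close>

definition ntk_gradient_flow ::
  "('a \<Rightarrow> 'a \<Rightarrow> real) \<Rightarrow> nat \<Rightarrow> (nat \<Rightarrow> 'a) \<Rightarrow> (nat \<Rightarrow> real) \<Rightarrow> ('a \<Rightarrow> real)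
     \<Rightarrow> (real \<Rightarrow> 'a \<Rightarrow> real) \<Rightarrow> bool" where
  "ntk_gradient_flow \<Theta> N xs ys F0 F \<longleftrightarrow>
     F 0 = F0 \<and>
     (\<forall>x. \<forall>t\<ge>0. ((\<lambda>s. F s x) has_real_derivative
                    - (\<Sum>i<N. \<Theta> x (xs i) * (F t (xs i) - ys i))) (at t within {0..}))"

definition fully_trained :: "(real \<Rightarrow> 'a \<Rightarrow> real) \<Rightarrow> 'a \<Rightarrow> real" where
  "fully_trained F x = Lim at_top (\<lambda>t. F t x)"

definition gram_pos_def :: "('a \<Rightarrow> 'a \<Rightarrow> real) \<Rightarrow> nat \<Rightarrow> (nat \<Rightarrow> 'a) \<Rightarrow> bool" where
  "gram_pos_def K N xs \<longleftrightarrow>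
     (\<forall>i<N. \<forall>j<N. K (xs i) (xs j) = K (xs j) (xs i)) \<and>
     (\<forall>v :: nat \<Rightarrow> real. (\<exists>i<N. v i \<noteq> 0) \<longrightarrow>
        0 < (\<Sum>i<N. \<Sum>j<N. v i * K (xs i) (xs j) * v j))"

end

theory Submission
  imports Defs
begin

text \<open>
  Training with a positive definite tangent kernel acts at \<open>x\<close> as an affine map: the limit is
  \<open>L F0 + \<Sum>j. a j * ys j\<close> with \<open>L h = h x - (\<Sum>j. a j * h (xs j))\<close> and \<open>a = \<Theta>(\<X>,\<X>)\<^sup>-\<^sup>1 \<Theta>(\<X>,x)\<close>.
  Hence \<open>f\<close> has variance \<open>E (L f0)\<^sup>2\<close> at \<open>x\<close>, whereas training \<open>u\<close> towards \<open>g\<close> leaves the error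
  \<open>L u0 - L g0\<close>. By independence and centredness its second moment is
  \<open>E (L u0)\<^sup>2 + E (L g0)\<^sup>2\<close>, and each summand is the same quadratic form in \<open>\<kappa>\<close>.

  The residual \<open>r\<close> solves \<open>r' = - K r\<close>. To get \<open>r \<rightarrow> 0\<close> without spectral theory, note that
  \<open>r\<^sup>T K\<^sup>-\<^sup>1 r + 2 t r\<^sup>T r\<close> is nonincreasing in \<open>t\<close>, so \<open>r\<^sup>T r = O(1 / t)\<close>.
\<close>

section \<open>Linear systems with a positive definite matrix\<close>

text \<open>Induction by bordering: padding vectors with 0 shows that the leading block inherits
  positivity, so it can be solved both for \<open>b\<close> and for the last column of
  \<open>K\<close>. What remains is one scalar equation whose coefficient, the Schur complement, is
  a value of the quadratic form and hence positive.\<close>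

lemma pos_def_linear_solvable:
  fixes K :: "nat \<Rightarrow> nat \<Rightarrow> real"
  assumes "\<forall>v. (\<exists>i<N. v i \<noteq> 0) \<longrightarrow> 0 < (\<Sum>i<N. \<Sum>j<N. v i * K i j * v j)"
  shows "\<exists>a. \<forall>i<N. (\<Sum>j<N. K i j * a j) = b i"
  using assms
proof (induction N arbitrary: b)
  case 0
  then show ?case by simp
next
  case (Suc N)
  have "\<forall>v :: nat \<Rightarrow> real. (\<exists>i<N. v i \<noteq> 0) \<longrightarrow> 0 < (\<Sum>i<N. \<Sum>j<N. v i * K i j * v j)"
  proof (intro allI impI)
    fix v :: "nat \<Rightarrow> real"
    assume "\<exists>i<N. v i \<noteq> 0"
    then have "0 < (\<Sum>i<Suc N. \<Sum>j<Suc N. (v(N := 0)) i * K i j * (v(N := 0)) j)"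
      by (intro Suc.prems[rule_format]) (auto intro: less_SucI)
    then show "0 < (\<Sum>i<N. \<Sum>j<N. v i * K i j * v j)" by simp
  qed
  note IH = Suc.IH[OF this]
  obtain p where p: "\<And>i. i < N \<Longrightarrow> (\<Sum>j<N. K i j * p j) = b i"
    using IH[of b] by blast
  obtain w where w: "\<And>i. i < N \<Longrightarrow> (\<Sum>j<N. K i j * w j) = K i N"
    using IH[of "\<lambda>i. K i N"] by blast
  \<comment> \<open>the Schur complement of the leading block\<close>
  define d where "d = K N N - (\<Sum>j<N. K N j * w j)"
  \<comment> \<open>Block elimination: \<open>v\<close> is orthogonal to the first \<open>N\<close>
    rows of \<open>K\<close>, and the last row maps it to \<open>d\<close>. As its last entry is 1,
    the quadratic form at \<open>v\<close> equals \<open>d\<close>.\<close>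
  define v where "v = (\<lambda>i. if i = N then 1 else - w i)"
  have Kv: "(\<Sum>j<Suc N. K i j * v j) = (if i = N then d else 0)" if "i < Suc N" for i
    using that w by (auto simp: v_def d_def sum_negf)
  have "0 < (\<Sum>i<Suc N. \<Sum>j<Suc N. v i * K i j * v j)"
    by (intro Suc.prems[rule_format] exI[of _ N]) (simp add: v_def)
  also have "\<dots> = (\<Sum>i<Suc N. v i * (\<Sum>j<Suc N. K i j * v j))"
    by (simp only: sum_distrib_left mult.assoc)
  also have "\<dots> = (\<Sum>i<Suc N. v i * (if i = N then d else 0))"
    using Kv by (intro sum.cong) auto
  also have "\<dots> = d"
    by (simp add: v_def)
  finally have d: "d > 0" .
  \<comment> \<open>The zero-padded \<open>p\<close> already satisfies the first \<open>N\<close>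
    equations. Adding a multiple of \<open>v\<close> changes only the last one, by
    \<open>q * d\<close>, and this choice of \<open>q\<close> repairs it.\<close>
  define q where "q = (b N - (\<Sum>j<N. K N j * p j)) / d"
  define a where "a = (\<lambda>j. (if j < N then p j else 0) + q * v j)"
  have "(\<Sum>j<Suc N. K i j * a j) = b i" if "i < Suc N" for i
  proof -
    have "(\<Sum>j<Suc N. K i j * a j)
        = (\<Sum>j<Suc N. K i j * (if j < N then p j else 0)) + q * (\<Sum>j<Suc N. K i j * v j)"
      unfolding a_def sum_distrib_left sum.distrib[symmetric]
      by (intro sum.cong) (simp_all add: algebra_simps)
    also have "\<dots> = (\<Sum>j<N. K i j * p j) + q * (if i = N then d else 0)"
      using Kv[OF that] by simp
    also have "\<dots> = b i"
      using d p[of i] that by (cases "i = N") (simp_all add: q_def)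
    finally show ?thesis .
  qed
  then show ?case by blast
qed

text \<open>Solving for the unit vectors gives the rows of \<open>C\<close>, and symmetry of
  \<open>K\<close> turns this into \<open>C K = I\<close>. Since \<open>K\<close> is onto, any
  \<open>r\<close> is \<open>K q\<close>, so \<open>C r = q\<close> and \<open>K (C r) = r\<close>;
  thus the left inverse is also a right inverse.\<close>

lemma pos_def_inverse:
  fixes K :: "nat \<Rightarrow> nat \<Rightarrow> real"
  assumes sym: "\<forall>i<N. \<forall>j<N. K i j = K j i"
    and pd: "\<forall>v. (\<exists>i<N. v i \<noteq> 0) \<longrightarrow> 0 < (\<Sum>i<N. \<Sum>j<N. v i * K i j * v j)"
  shows "\<exists>C :: nat \<Rightarrow> nat \<Rightarrow> real.
      (\<forall>i<N. \<forall>k<N. (\<Sum>j<N. C i j * K j k) = (if i = k then 1 else 0)) \<and>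
      (\<forall>r. \<forall>i<N. (\<Sum>j<N. K i j * (\<Sum>k<N. C j k * r k)) = r i)"
proof -
  have "\<exists>c. \<forall>k<N. (\<Sum>j<N. K k j * c j) = (if i = k then 1 else 0)" for i
    by (rule pos_def_linear_solvable[OF pd])
  then have "\<exists>C. \<forall>i. \<forall>k<N. (\<Sum>j<N. K k j * C i j) = (if i = k then 1 else 0)"
    by (intro choice allI)
  then obtain C where C: "\<forall>i. \<forall>k<N. (\<Sum>j<N. K k j * C i j) = (if i = k then 1 else 0)"
    by (rule exE)
  have left: "(\<Sum>j<N. C i j * K j k) = (if i = k then 1 else 0)" if "i < N" "k < N" for i k
  proof -
    have "(\<Sum>j<N. C i j * K j k) = (\<Sum>j<N. K k j * C i j)"
      using sym that by (intro sum.cong refl) (simp add: mult.commute)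
    then show ?thesis using C that by simp
  qed
  have right: "(\<Sum>j<N. K i j * (\<Sum>k<N. C j k * r k)) = r i" if "i < N" for r i
  proof -
    obtain q where q: "\<And>i. i < N \<Longrightarrow> (\<Sum>j<N. K i j * q j) = r i"
      using pos_def_linear_solvable[OF pd, where b = r] by blast
    have "(\<Sum>k<N. C j k * r k) = q j" if "j < N" for j
    proof -
      have "(\<Sum>k<N. C j k * r k) = (\<Sum>k<N. \<Sum>l<N. C j k * K k l * q l)"
        by (intro sum.cong refl) (simp add: q[symmetric] sum_distrib_left mult.assoc)
      also have "\<dots> = (\<Sum>l<N. (\<Sum>k<N. C j k * K k l) * q l)"
        by (subst sum.swap) (simp add: sum_distrib_right)
      also have "\<dots> = (\<Sum>l<N. (if j = l then 1 else 0) * q l)"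
        using left that by (intro sum.cong) auto
      also have "\<dots> = q j"
        using that by (simp add: if_distrib[of "\<lambda>z. z * _"] cong: if_cong)
      finally show ?thesis .
    qed
    then show ?thesis using q[OF that] by simp
  qed
  from left right show ?thesis by blast
qed

section \<open>Decay of the residual\<close>

lemma nonincreasing_on_half_line:
  fixes f :: "real \<Rightarrow> real"
  assumes "\<And>t. t \<ge> 0 \<Longrightarrow> (f has_real_derivative f' t) (at t within {0..})"
    and "\<And>t. t \<ge> 0 \<Longrightarrow> f' t \<le> 0" and "t \<ge> 0"
  shows "f t \<le> f 0"
proof -
  have "\<exists>s\<in>{0..t}. f t - f 0 = f' s * (t - 0)"
    using assms(3)
    by (intro mvt_very_simple)
       (auto simp flip: has_field_derivative_def intro: DERIV_subset[OF assms(1)])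
  then obtain s where s: "s \<ge> 0" "f t - f 0 = f' s * t" by auto
  have "f' s * t \<le> 0"
    using assms(2)[OF s(1)] assms(3) by (rule mult_nonpos_nonneg)
  then show ?thesis using s(2) by linarith
qed

lemma linear_decay:
  fixes K :: "nat \<Rightarrow> nat \<Rightarrow> real" and r :: "nat \<Rightarrow> real \<Rightarrow> real"
  assumes sym: "\<forall>i<N. \<forall>j<N. K i j = K j i"
    and pd: "\<forall>v. (\<exists>i<N. v i \<noteq> 0) \<longrightarrow> 0 < (\<Sum>i<N. \<Sum>j<N. v i * K i j * v j)"
    and der: "\<And>i t. i < N \<Longrightarrow> t \<ge> 0 \<Longrightarrow>
      (r i has_real_derivative - (\<Sum>j<N. K i j * r j t)) (at t within {0..})"
    and "i < N"
  shows "(r i \<longlongrightarrow> 0) at_top"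
proof -
  obtain C where
    left: "\<forall>i<N. \<forall>k<N. (\<Sum>j<N. C i j * K j k) = (if i = k then 1 else 0)"
    and right: "\<forall>r. \<forall>i<N. (\<Sum>j<N. K i j * (\<Sum>k<N. C j k * r k)) = r i"
    using pos_def_inverse[OF sym pd] by blast
  have psd: "0 \<le> (\<Sum>i<N. \<Sum>j<N. v i * K i j * v j)" for v
  proof (cases "\<exists>i<N. v i \<noteq> 0")
    case True
    then show ?thesis using pd[rule_format, of v] by simp
  next
    case False
    then have "(\<Sum>i<N. \<Sum>j<N. v i * K i j * v j) = 0" by (intro sum.neutral) auto
    then show ?thesis by simp
  qed
  \<comment> \<open>\<open>s\<close> is K^-1 r. The right inverse recovers \<open>r\<close> as
    \<open>K s\<close>, and the left inverse gives s' = - C K r = - r.\<close>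
  define s where "s = (\<lambda>i t. \<Sum>k<N. C i k * r k t)"
  have Ks: "(\<Sum>j<N. K i j * s j t) = r i t" if "i < N" for i t
    using right that by (simp add: s_def)
  have sder: "(s i has_real_derivative - r i t) (at t within {0..})" if "i < N" "t \<ge> 0" for i t
  proof -
    have "(s i has_real_derivative (\<Sum>k<N. C i k * (- (\<Sum>j<N. K k j * r j t)))) (at t within {0..})"
      unfolding s_def using that by (intro DERIV_sum DERIV_cmult der) auto
    moreover have "(\<Sum>k<N. C i k * (- (\<Sum>j<N. K k j * r j t)))
        = - (\<Sum>j<N. (\<Sum>k<N. C i k * K k j) * r j t)"
      by (simp add: sum_distrib_left sum_distrib_right sum_negf mult.assoc)
         (rule sum.swap)
    moreover have "(\<Sum>j<N. (\<Sum>k<N. C i k * K k j) * r j t) = (\<Sum>j<N. (if i = j then 1 else 0) * r j t)"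
      using left that by (intro sum.cong) auto
    ultimately show ?thesis
      using that by (simp add: if_distrib[of "\<lambda>z. z * _"] cong: if_cong)
  qed
  \<comment> \<open>Here V = r^T r, W = r^T K^-1 r and Q = r^T K r. Then V' = -2 Q and W' = -2 V, so
    W + 2 t V has derivative -4 t Q, which is nonpositive for t \<ge> 0.\<close>
  define V where "V = (\<lambda>t. \<Sum>i<N. r i t * r i t)"
  define W where "W = (\<lambda>t. \<Sum>i<N. s i t * r i t)"
  define Q where "Q = (\<lambda>t. \<Sum>i<N. \<Sum>j<N. r i t * K i j * r j t)"
  \<comment> \<open>Substituting r = K s turns W into s^T K s, so positivity of the inverse matrix
    needs no separate argument.\<close>
  have W_nonneg: "W t \<ge> 0" for t
  proof -
    have "W t = (\<Sum>i<N. \<Sum>j<N. s i t * K i j * s j t)"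
      unfolding W_def
      by (intro sum.cong) (simp_all add: Ks[symmetric] sum_distrib_left mult.assoc)
    then show ?thesis using psd[of "\<lambda>i. s i t"] by simp
  qed
  have Vder: "(V has_real_derivative - 2 * Q t) (at t within {0..})" if "t \<ge> 0" for t
  proof -
    have "(V has_real_derivative (\<Sum>i<N. - (\<Sum>j<N. K i j * r j t) * r i t
        + - (\<Sum>j<N. K i j * r j t) * r i t)) (at t within {0..})"
      unfolding V_def using that by (intro DERIV_sum DERIV_mult der) auto
    moreover have "(\<Sum>i<N. - (\<Sum>j<N. K i j * r j t) * r i t + - (\<Sum>j<N. K i j * r j t) * r i t)
        = - 2 * Q t"
      unfolding Q_def sum_distrib_left
      by (intro sum.cong) (simp_all add: sum_distrib_left sum_distrib_right sum_negf algebra_simps)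
    ultimately show ?thesis by simp
  qed
  have Wder: "(W has_real_derivative - 2 * V t) (at t within {0..})" if "t \<ge> 0" for t
  proof -
    have "(W has_real_derivative (\<Sum>i<N. - r i t * r i t
        + - (\<Sum>j<N. K i j * r j t) * s i t)) (at t within {0..})"
      unfolding W_def using that by (intro DERIV_sum DERIV_mult der sder) auto
    \<comment> \<open>Symmetry moves \<open>K\<close> to the other factor: (K r)^T s = r^T (K s) =
      r^T r.\<close>
    moreover have "(\<Sum>i<N. (\<Sum>j<N. K i j * r j t) * s i t) = V t"
    proof -
      have "(\<Sum>i<N. (\<Sum>j<N. K i j * r j t) * s i t) = (\<Sum>j<N. \<Sum>i<N. K i j * r j t * s i t)"
        unfolding sum_distrib_right by (rule sum.swap)
      also have "\<dots> = (\<Sum>j<N. r j t * (\<Sum>i<N. K j i * s i t))"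
        unfolding sum_distrib_left using sym by (intro sum.cong) auto
      also have "\<dots> = V t"
        using Ks by (simp add: V_def)
      finally show ?thesis .
    qed
    then have "(\<Sum>i<N. - r i t * r i t + - (\<Sum>j<N. K i j * r j t) * s i t) = - 2 * V t"
      by (simp add: sum_subtractf sum_negf V_def)
    ultimately show ?thesis by simp
  qed
  have bound: "V t \<le> W 0 / 2 / t" if "t > 0" for t
  proof -
    have "W t + 2 * (t * V t) \<le> W 0 + 2 * (0 * V 0)"
    proof (rule nonincreasing_on_half_line[where f = "\<lambda>t. W t + 2 * (t * V t)"])
      show "((\<lambda>t. W t + 2 * (t * V t)) has_real_derivative
          - 2 * V t + 2 * (1 * V t + - 2 * Q t * t)) (at t within {0..})" if "t \<ge> 0" for t
        using that by (intro DERIV_add DERIV_cmult DERIV_mult DERIV_ident Wder Vder)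
      show "- 2 * V t + 2 * (1 * V t + - 2 * Q t * t) \<le> 0" if "t \<ge> 0" for t
        using that psd[of "\<lambda>i. r i t"] by (simp add: Q_def)
    qed (use that in simp)
    then have "t * V t \<le> W 0 / 2"
      using W_nonneg[of t] by simp
    then show ?thesis
      using that by (simp add: pos_le_divide_eq algebra_simps)
  qed
  have upper: "((\<lambda>t. W 0 / 2 / t) \<longlongrightarrow> 0) at_top"
    by (intro tendsto_divide_0[OF tendsto_const] filterlim_at_top_imp_at_infinity filterlim_ident)
  have "((\<lambda>t. (r i t)\<^sup>2) \<longlongrightarrow> 0) at_top"
  proof (rule tendsto_sandwich[OF _ _ tendsto_const upper])
    show "\<forall>\<^sub>F t in at_top. 0 \<le> (r i t)\<^sup>2" by simp
    have rV: "(r i t)\<^sup>2 \<le> V t" for t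
      unfolding V_def power2_eq_square using \<open>i < N\<close> by (intro member_le_sum) auto
    show "\<forall>\<^sub>F t in at_top. (r i t)\<^sup>2 \<le> W 0 / 2 / t"
      using eventually_gt_at_top[of 0] by eventually_elim (rule order.trans[OF rV bound])
  qed
  then show ?thesis by simp
qed

section \<open>The limit of training as an affine map\<close>

text \<open>The residuals vanish, and a fixed combination of them, subtracted from the value at
  \<open>x\<close>, is conserved; comparing time 0 with the limit gives the formula. The
  coefficients \<open>a\<close> are obtained before the labels and the initial function, so the same
  map serves \<open>f\<close> and \<open>u\<close> and every outcome.\<close>

lemma ntk_gradient_flow_limit:
  fixes \<Theta> :: "'a \<Rightarrow> 'a \<Rightarrow> real"
  assumes "gram_pos_def \<Theta> N xs"
  obtains a :: "nat \<Rightarrow> real"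
  where "\<And>ys F0 F. ntk_gradient_flow \<Theta> N xs ys F0 F \<Longrightarrow>
      ((\<lambda>t. F t x) \<longlongrightarrow> F0 x + (\<Sum>j<N. a j * (ys j - F0 (xs j)))) at_top"
proof -
  have sym: "\<forall>i<N. \<forall>j<N. \<Theta> (xs i) (xs j) = \<Theta> (xs j) (xs i)"
    and pd: "\<forall>v. (\<exists>i<N. v i \<noteq> 0) \<longrightarrow> 0 < (\<Sum>i<N. \<Sum>j<N. v i * \<Theta> (xs i) (xs j) * v j)"
    using assms unfolding gram_pos_def_def by simp_all
  obtain a where a: "\<And>i. i < N \<Longrightarrow> (\<Sum>j<N. \<Theta> (xs i) (xs j) * a j) = \<Theta> x (xs i)"
    using pos_def_linear_solvable[OF pd, where b = "\<lambda>i. \<Theta> x (xs i)"] by blast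
  show ?thesis
  proof (rule that[of a])
    fix ys F0 F
    assume "ntk_gradient_flow \<Theta> N xs ys F0 F"
    then have F0: "F 0 = F0"
      and der: "\<And>y t. t \<ge> 0 \<Longrightarrow> ((\<lambda>s. F s y) has_real_derivative
            - (\<Sum>i<N. \<Theta> y (xs i) * (F t (xs i) - ys i))) (at t within {0..})"
      unfolding ntk_gradient_flow_def by auto
    define r where "r = (\<lambda>i t. F t (xs i) - ys i)"
    have rder: "(r i has_real_derivative - (\<Sum>j<N. \<Theta> (xs i) (xs j) * r j t)) (at t within {0..})"
      if "i < N" "t \<ge> 0" for i t
      unfolding r_def using DERIV_diff[OF der[OF that(2)] DERIV_const] by simp
    have lim_r: "(r i \<longlongrightarrow> 0) at_top" if "i < N" for i
      by (rule linear_decay[OF sym pd _ that]) (rule rder)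
    \<comment> \<open>conserved, since the row of the kernel at \<open>x\<close> is a combination of the rows at the \<open>xs j\<close>\<close>
    define G where "G = (\<lambda>t. F t x - (\<Sum>j<N. a j * r j t))"
    have "(G has_real_derivative 0) (at t within {0..})" if "t \<in> {0..}" for t
    proof -
      have "(\<Sum>j<N. a j * (\<Sum>i<N. \<Theta> (xs j) (xs i) * r i t))
          = (\<Sum>i<N. \<Sum>j<N. a j * (\<Theta> (xs j) (xs i) * r i t))"
        unfolding sum_distrib_left by (rule sum.swap)
      also have "\<dots> = (\<Sum>i<N. (\<Sum>j<N. \<Theta> (xs i) (xs j) * a j) * r i t)"
        unfolding sum_distrib_right using sym by (intro sum.cong) auto
      also have "\<dots> = (\<Sum>i<N. \<Theta> x (xs i) * r i t)"
        using a by simp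
      finally have eq: "(\<Sum>j<N. a j * (\<Sum>i<N. \<Theta> (xs j) (xs i) * r i t)) = (\<Sum>i<N. \<Theta> x (xs i) * r i t)" .
      have "(G has_real_derivative - (\<Sum>i<N. \<Theta> x (xs i) * (F t (xs i) - ys i))
          - (\<Sum>j<N. a j * - (\<Sum>i<N. \<Theta> (xs j) (xs i) * r i t))) (at t within {0..})"
        unfolding G_def using that by (intro DERIV_diff DERIV_sum DERIV_cmult der rder) auto
      then show ?thesis
        using eq by (simp add: sum_negf r_def)
    qed
    then obtain c where c: "\<And>t. t \<ge> 0 \<Longrightarrow> G t = c"
      using has_field_derivative_zero_constant[of "{0..}" G] by auto
    have "((\<lambda>t. G 0 + (\<Sum>j<N. a j * r j t)) \<longlongrightarrow> G 0 + (\<Sum>j<N. a j * 0)) at_top"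
      by (intro tendsto_intros lim_r) auto
    moreover have "G 0 + (\<Sum>j<N. a j * r j t) = F t x" if "t \<ge> 0" for t
      using c[OF that] c[of 0] unfolding G_def by linarith
    then have "\<forall>\<^sub>F t in at_top. G 0 + (\<Sum>j<N. a j * r j t) = F t x"
      using eventually_ge_at_top[of 0] by (rule eventually_mono[rotated])
    ultimately have "((\<lambda>t. F t x) \<longlongrightarrow> G 0) at_top"
      by (simp add: Lim_transform_eventually)
    moreover have "G 0 = F0 x + (\<Sum>j<N. a j * (ys j - F0 (xs j)))"
      by (simp add: G_def r_def F0 sum_subtractf right_diff_distrib)
    ultimately show "((\<lambda>t. F t x) \<longlongrightarrow> F0 x + (\<Sum>j<N. a j * (ys j - F0 (xs j)))) at_top"
      by simp
  qed
qed

section \<open>Second moments of Gaussian processes\<close>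

lemma gaussian_law_square_integrable:
  assumes "gaussian_law D"
  shows "integrable D (\<lambda>x. x\<^sup>2)"
proof -
  consider m where "D = return borel m"
    | m s where "0 < s" "D = density lborel (normal_density m s)"
    using assms unfolding gaussian_law_def by blast
  then show ?thesis
  proof cases
    case 1
    have "AE x in D. x\<^sup>2 = m\<^sup>2"
      unfolding 1 by (subst AE_return) auto
    moreover have "integrable D (\<lambda>_. m\<^sup>2)"
      by (intro finite_measure.integrable_const prob_space.finite_measure)
         (simp add: 1 prob_space_return)
    ultimately show ?thesis
      by (subst integrable_cong_AE[where g = "\<lambda>_. m\<^sup>2"]) (simp_all add: 1)
  next
    case 2
    \<comment> \<open>This is x^2 = (x - m)^2 + 2 m x - m^2 under the density, which reduces the
      claim to the central second moment, the mean and the total mass.\<close>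
    have "integrable lborel (\<lambda>x. normal_density m s x * (x - m)\<^sup>2
        + 2 * m * (normal_density m s x * x) - m\<^sup>2 * normal_density m s x)"
      using 2(1) integrable_normal_moment[of s m 2] integrable_normal_moment_nz_1[of s m]
      by (intro Bochner_Integration.integrable_add Bochner_Integration.integrable_diff
          integrable_mult_right integrable_normal_density) auto
    then have "integrable lborel (\<lambda>x. normal_density m s x * x\<^sup>2)"
      by (rule Bochner_Integration.integrable_cong[THEN iffD1, rotated -1])
         (auto simp: power2_eq_square algebra_simps)
    then show ?thesis
      unfolding 2 by (subst integrable_density) (auto simp: normal_density_nonneg)
  qed
qed

lemma integrable_mult_of_squares:
  fixes X Y :: "'a \<Rightarrow> real"
  assumes "X \<in> borel_measurable M" "Y \<in> borel_measurable M"
    and "integrable M (\<lambda>\<omega>. (X \<omega>)\<^sup>2)" "integrable M (\<lambda>\<omega>. (Y \<omega>)\<^sup>2)"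
  shows "integrable M (\<lambda>\<omega>. X \<omega> * Y \<omega>)"
proof (rule Bochner_Integration.integrable_bound)
  show "integrable M (\<lambda>\<omega>. (X \<omega>)\<^sup>2 + (Y \<omega>)\<^sup>2)"
    using assms by simp
  show "AE \<omega> in M. norm (X \<omega> * Y \<omega>) \<le> norm ((X \<omega>)\<^sup>2 + (Y \<omega>)\<^sup>2)"
  proof (rule AE_I2)
    fix \<omega>
    have "2 * \<bar>X \<omega>\<bar> * \<bar>Y \<omega>\<bar> \<le> \<bar>X \<omega>\<bar>\<^sup>2 + \<bar>Y \<omega>\<bar>\<^sup>2"
      by (rule sum_squares_bound)
    moreover have "0 \<le> \<bar>X \<omega>\<bar> * \<bar>Y \<omega>\<bar>" by simp
    ultimately show "norm (X \<omega> * Y \<omega>) \<le> norm ((X \<omega>)\<^sup>2 + (Y \<omega>)\<^sup>2)"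
      unfolding real_norm_def abs_mult power2_abs by linarith
  qed
qed (use assms in measurable)

text \<open>The covariance identity alone would not give this, since the Bochner integral of a
  non-integrable function is 0. Integrability comes from the Gaussian law of the marginal at the
  single point \<open>x\<close>.\<close>

lemma centered_gp_square_integrable:
  assumes "centered_gp M \<kappa> Z"
  shows "integrable M (\<lambda>\<omega>. (Z \<omega> x)\<^sup>2)"
proof -
  have [measurable]: "(\<lambda>\<omega>. Z \<omega> x) \<in> borel_measurable M"
    and law: "\<And>S c. finite S \<Longrightarrow> gaussian_law (distr M borel (\<lambda>\<omega>. \<Sum>a\<in>S. c a * Z \<omega> a))"
    using assms unfolding centered_gp_def gaussian_process_def by auto
  have "gaussian_law (distr M borel (\<lambda>\<omega>. Z \<omega> x))"
    using law[of "{x}" "\<lambda>_. 1"] by simp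
  then have "integrable (distr M borel (\<lambda>\<omega>. Z \<omega> x)) (\<lambda>x. x\<^sup>2)"
    by (rule gaussian_law_square_integrable)
  then show ?thesis
    by (subst (asm) integrable_distr_eq) auto
qed

text \<open>The second moment depends on the process only through \<kappa>, which later makes
  \<open>f0\<close>, \<open>u0\<close> and \<open>g0\<close> interchangeable. Points are indexed
  through \<open>p\<close>, so they may repeat, as when the test point is a training point.\<close>

lemma (in prob_space) centered_gp_combination:
  fixes Z :: "'a \<Rightarrow> 'b \<Rightarrow> real" and p :: "'i \<Rightarrow> 'b" and c :: "'i \<Rightarrow> real"
  assumes gp: "centered_gp M \<kappa> Z" and "finite I"
  defines "L \<equiv> \<lambda>\<omega>. \<Sum>i\<in>I. c i * Z \<omega> (p i)"
  shows "L \<in> borel_measurable M" "integrable M L" "expectation L = 0"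
    and "integrable M (\<lambda>\<omega>. (L \<omega>)\<^sup>2)"
    and "expectation (\<lambda>\<omega>. (L \<omega>)\<^sup>2) = (\<Sum>i\<in>I. \<Sum>j\<in>I. c i * c j * \<kappa> (p i) (p j))"
proof -
  have meas [measurable]: "\<And>x. (\<lambda>\<omega>. Z \<omega> x) \<in> borel_measurable M"
    and mean: "\<And>x. expectation (\<lambda>\<omega>. Z \<omega> x) = 0"
    and cov: "\<And>x y. expectation (\<lambda>\<omega>. Z \<omega> x * Z \<omega> y) = \<kappa> x y"
    using gp unfolding centered_gp_def gaussian_process_def by auto
  note sq = centered_gp_square_integrable[OF gp]
  have int: "integrable M (\<lambda>\<omega>. Z \<omega> x)" for x
    by (rule square_integrable_imp_integrable[OF meas sq])
  have prod: "integrable M (\<lambda>\<omega>. Z \<omega> x * Z \<omega> y)" for x y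
    by (intro integrable_mult_of_squares meas sq)
  show "L \<in> borel_measurable M" unfolding L_def by measurable
  show "integrable M L" unfolding L_def using int by simp
  show "expectation L = 0" unfolding L_def using int mean by simp
  have L2: "(\<lambda>\<omega>. (L \<omega>)\<^sup>2) = (\<lambda>\<omega>. \<Sum>i\<in>I. \<Sum>j\<in>I. c i * c j * (Z \<omega> (p i) * Z \<omega> (p j)))"
    by (simp add: L_def power2_eq_square sum_product algebra_simps)
  show "integrable M (\<lambda>\<omega>. (L \<omega>)\<^sup>2)" unfolding L2 using prod by simp
  show "expectation (\<lambda>\<omega>. (L \<omega>)\<^sup>2) = (\<Sum>i\<in>I. \<Sum>j\<in>I. c i * c j * \<kappa> (p i) (p j))"
    unfolding L2 using prod by (simp add: cov)
qed

section \<open>Second moment of the error and variance of the prediction\<close>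

text \<open>The convergence claims exclude the arbitrary value of \<open>Lim\<close> for a divergent
  flow, and the integrability claims guard against the default value 0 of the Bochner
  integral.\<close>

theorem corollary3p2:
  fixes A :: arch
    and \<kappa> \<Theta> :: "real ^ 'd \<Rightarrow> real ^ 'd \<Rightarrow> real"
    and M :: "'w measure"
    and f0 u0 g0 :: "'w \<Rightarrow> real ^ 'd \<Rightarrow> real"
    and N :: nat and xs :: "nat \<Rightarrow> real ^ 'd" and ys :: "nat \<Rightarrow> real"
    and f u :: "'w \<Rightarrow> real \<Rightarrow> real ^ 'd \<Rightarrow> real"
    and x :: "real ^ 'd"
  defines "\<epsilon> \<equiv> \<lambda>\<omega> x. fully_trained (u \<omega>) x - g0 \<omega> x"
  assumes "1 \<le> depth A" and "\<exists>C. C-lipschitz_on UNIV (act A)"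
    and "is_nngp_kernel A \<kappa>" and "is_ntk A \<Theta>"
    and "prob_space M"
    and "infinite_width_init A \<kappa> M f0"
    and "infinite_width_init A \<kappa> M u0"
    and "infinite_width_init A \<kappa> M g0"
    and "prob_space.indep_vars M (\<lambda>_. PiM UNIV (\<lambda>_. borel))
           (\<lambda>i \<omega>. [f0 \<omega>, u0 \<omega>, g0 \<omega>] ! i) {..<3}"
    and "gram_pos_def \<Theta> N xs"
    and "\<And>\<omega>. \<omega> \<in> space M \<Longrightarrow> ntk_gradient_flow \<Theta> N xs ys (f0 \<omega>) (f \<omega>)"
    and "\<And>\<omega>. \<omega> \<in> space M \<Longrightarrow> ntk_gradient_flow \<Theta> N xs (\<lambda>i. g0 \<omega> (xs i)) (u0 \<omega>) (u \<omega>)"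
  shows "(\<forall>\<omega>\<in>space M. ((\<lambda>t. f \<omega> t x) \<longlongrightarrow> fully_trained (f \<omega>) x) at_top)
       \<and> (\<forall>\<omega>\<in>space M. ((\<lambda>t. u \<omega> t x) \<longlongrightarrow> fully_trained (u \<omega>) x) at_top)
       \<and> integrable M (\<lambda>\<omega>. (fully_trained (f \<omega>) x)\<^sup>2)
       \<and> integrable M (\<lambda>\<omega>. (\<epsilon> \<omega> x)\<^sup>2)
       \<and> 1 / 2 * prob_space.expectation M (\<lambda>\<omega>. (\<epsilon> \<omega> x)\<^sup>2)
           = prob_space.variance M (\<lambda>\<omega>. fully_trained (f \<omega>) x)"
proof -
  interpret prob_space M by fact
  have gp: "centered_gp M \<kappa> f0" "centered_gp M \<kappa> u0" "centered_gp M \<kappa> g0"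
    using assms(7-9) unfolding infinite_width_init_def by auto
  obtain a where lim: "\<And>ys F0 F. ntk_gradient_flow \<Theta> N xs ys F0 F \<Longrightarrow>
      ((\<lambda>t. F t x) \<longlongrightarrow> F0 x + (\<Sum>j<N. a j * (ys j - F0 (xs j)))) at_top"
    using ntk_gradient_flow_limit[OF \<open>gram_pos_def \<Theta> N xs\<close>] by metis
  have trained: "fully_trained F x = F0 x + (\<Sum>j<N. a j * (ys j - F0 (xs j)))"
    if "ntk_gradient_flow \<Theta> N xs ys F0 F" for ys F0 F
    unfolding fully_trained_def using lim[OF that] by (intro tendsto_Lim) auto
  \<comment> \<open>The test point is appended to the training points at index \<open>N\<close> with
    coefficient 1, so that \<open>L\<close> is a single finite combination of process
    values.\<close>
  define p where "p = (\<lambda>i. if i = N then x else xs i)"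
  define c where "c = (\<lambda>i. if i = N then 1 else - a i)"
  define L where "L = (\<lambda>h. \<Sum>i<Suc N. c i * h (p i))"
  define b where "b = (\<Sum>j<N. a j * ys j)"
  define S where "S = (\<Sum>i<Suc N. \<Sum>j<Suc N. c i * c j * \<kappa> (p i) (p j))"
  have L_eq: "L h = h x - (\<Sum>j<N. a j * h (xs j))" for h
    by (simp add: L_def p_def c_def sum_negf)
  \<comment> \<open>Fixed labels enter only through the constant \<open>b\<close>, which the
    variance does not see.\<close>
  have f_eq: "fully_trained (f \<omega>) x = L (f0 \<omega>) + b" if "\<omega> \<in> space M" for \<omega>
    using trained[OF assms(12)[OF that]]
    by (simp add: L_eq b_def right_diff_distrib sum_subtractf)
  \<comment> \<open>Here the labels are values of \<open>g0\<close>: their contribution to the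
    trained \<open>u\<close>, minus \<open>g0\<close> at \<open>x\<close>, is exactly - L
    g0.\<close>
  have e_eq: "\<epsilon> \<omega> x = L (u0 \<omega>) - L (g0 \<omega>)" if "\<omega> \<in> space M" for \<omega>
    using trained[OF assms(13)[OF that]]
    by (simp add: L_eq \<epsilon>_def right_diff_distrib sum_subtractf)
  have comb: "(\<lambda>\<omega>. L (Z \<omega>)) \<in> borel_measurable M" "integrable M (\<lambda>\<omega>. L (Z \<omega>))"
    "expectation (\<lambda>\<omega>. L (Z \<omega>)) = 0" "integrable M (\<lambda>\<omega>. (L (Z \<omega>))\<^sup>2)"
    "expectation (\<lambda>\<omega>. (L (Z \<omega>))\<^sup>2) = S" if "centered_gp M \<kappa> Z" for Z
    unfolding L_def S_def by (rule centered_gp_combination[OF that finite_lessThan])+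
  note F = comb[OF gp(1)] and U = comb[OF gp(2)] and G = comb[OF gp(3)]
  \<comment> \<open>\<open>L\<close> reads finitely many coordinates, so it is measurable for the
    product sigma-algebra, and independence of the processes passes to their images under
    \<open>L\<close>.\<close>
  have meas_L: "L \<in> borel_measurable (PiM UNIV (\<lambda>_. borel))"
    unfolding L_def by measurable
  have "indep_vars (\<lambda>_. borel) (\<lambda>i \<omega>. L ([f0 \<omega>, u0 \<omega>, g0 \<omega>] ! i)) {..<3::nat}"
    using assms(10) meas_L by (rule indep_vars_compose2)
  \<comment> \<open>Indices 1 and 2 pick \<open>u0\<close> and \<open>g0\<close>; the mean of their
    product factors into two zero means.\<close>
  then have "indep_vars (\<lambda>_. borel) (\<lambda>i \<omega>. L ([f0 \<omega>, u0 \<omega>, g0 \<omega>] ! i)) {1, 2::nat}"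
    by (rule indep_vars_subset) auto
  then have "expectation (\<lambda>\<omega>. \<Prod>i\<in>{1, 2::nat}. L ([f0 \<omega>, u0 \<omega>, g0 \<omega>] ! i))
      = (\<Prod>i\<in>{1, 2::nat}. expectation (\<lambda>\<omega>. L ([f0 \<omega>, u0 \<omega>, g0 \<omega>] ! i)))"
    using U(2) G(2) by (intro indep_vars_lebesgue_integral) (auto simp: numeral_2_eq_2)
  then have cross: "expectation (\<lambda>\<omega>. L (u0 \<omega>) * L (g0 \<omega>)) = 0"
    using U(3) by (simp add: numeral_2_eq_2)
  have cross_int: "integrable M (\<lambda>\<omega>. L (u0 \<omega>) * L (g0 \<omega>))"
    by (intro integrable_mult_of_squares U G)
  have e2: "(\<epsilon> \<omega> x)\<^sup>2 = (L (u0 \<omega>))\<^sup>2 + (L (g0 \<omega>))\<^sup>2 - 2 * (L (u0 \<omega>) * L (g0 \<omega>))"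
    if "\<omega> \<in> space M" for \<omega>
    unfolding e_eq[OF that] by (simp add: power2_diff)
  have int_f: "integrable M (\<lambda>\<omega>. (fully_trained (f \<omega>) x)\<^sup>2)"
  proof -
    have "integrable M (\<lambda>\<omega>. (L (f0 \<omega>))\<^sup>2 + 2 * b * L (f0 \<omega>) + b\<^sup>2)"
      using F(2,4) by simp
    then show ?thesis
      by (rule Bochner_Integration.integrable_cong[THEN iffD1, rotated -1])
         (auto simp: f_eq power2_sum)
  qed
  have int_e: "integrable M (\<lambda>\<omega>. (\<epsilon> \<omega> x)\<^sup>2)"
    using U(4) G(4) cross_int
    by (subst Bochner_Integration.integrable_cong[OF refl e2]) auto
  have "expectation (\<lambda>\<omega>. (\<epsilon> \<omega> x)\<^sup>2) = expectation (\<lambda>\<omega>. (L (u0 \<omega>))\<^sup>2 + (L (g0 \<omega>))\<^sup>2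
      - 2 * (L (u0 \<omega>) * L (g0 \<omega>)))"
    by (rule Bochner_Integration.integral_cong[OF refl e2])
  also have "\<dots> = 2 * S"
    using U(4,5) G(4,5) cross cross_int by simp
  finally have Ee: "expectation (\<lambda>\<omega>. (\<epsilon> \<omega> x)\<^sup>2) = 2 * S" .
  have "expectation (\<lambda>\<omega>. fully_trained (f \<omega>) x) = expectation (\<lambda>\<omega>. L (f0 \<omega>) + b)"
    by (rule Bochner_Integration.integral_cong) (auto simp: f_eq)
  also have "\<dots> = b"
    using F(2,3) by (simp add: prob_space)
  \<comment> \<open>The mean is \<open>b\<close>, so centring leaves just
    \<open>L (f0 \<omega>)\<close>.\<close>
  finally have "variance (\<lambda>\<omega>. fully_trained (f \<omega>) x) = expectation (\<lambda>\<omega>. (L (f0 \<omega>))\<^sup>2)"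
    by (intro Bochner_Integration.integral_cong) (auto simp: f_eq)
  then have "variance (\<lambda>\<omega>. fully_trained (f \<omega>) x) = S"
    using F(5) by simp
  moreover have "((\<lambda>t. f \<omega> t x) \<longlongrightarrow> fully_trained (f \<omega>) x) at_top" if "\<omega> \<in> space M" for \<omega>
    using lim[OF assms(12)[OF that]] trained[OF assms(12)[OF that]] by simp
  moreover have "((\<lambda>t. u \<omega> t x) \<longlongrightarrow> fully_trained (u \<omega>) x) at_top" if "\<omega> \<in> space M" for \<omega>
    using lim[OF assms(13)[OF that]] trained[OF assms(13)[OF that]] by simp
  ultimately show ?thesis
    using int_f int_e Ee by simp
qed

end
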